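(* Let $n\geq 4$ and $2\leq l\leq n-2$ be integers. Then $T_n(l)$ is regular if and only if $n$ is even and $l=\frac{n}{2}$.
   Context: For an integer $n\geq 2$, $X_n=\{1,2,\dots,n\}$ and $T_n$ is the full transformation semigroup on $X_n$ (all functions $X_n\to X_n$ under composition). The image of $x$ under $\alpha$ is written $x\alpha$, and functions are composed from left to right: $x(\alpha\beta)=(x\alpha)\beta$. For an integer $l$ with $1\leq l\leq n-1$, $T_n(l)=\{\alpha\in T_n : \forall x,y\in X_n,\ |x-y|=l \Rightarrow |x\alpha-y\alpha|=l\}$, which is a subsemigroup of $T_n$. A semigroup $S$ is regular if for every $a\in S$ there exists $b\in S$ with $a=aba$. *)

theory Defs
  imports "HOL-Algebra.Group"
begin

text \<open>A transformation of \<open>{1..n}\<close> is an extensional function (undefined outside \<open>{1..n}\<close>), so that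
  equality of functions is equality on \<open>{1..n}\<close>.  Functions act on the right and products are taken
  from left to right: \<open>x (\<alpha> \<beta>) = (x \<alpha>) \<beta>\<close>, whereas \<open>compose A g f\<close> applies \<open>f\<close> first.\<close>

definition full_transf :: "nat \<Rightarrow> (nat \<Rightarrow> nat) monoid" where
  "full_transf n =
    \<lparr>carrier = {1..n} \<rightarrow>\<^sub>E {1..n},
     mult = (\<lambda>\<alpha> \<beta>. compose {1..n} \<beta> \<alpha>),
     one = (\<lambda>x\<in>{1..n}. x)\<rparr>"

definition dist_transf :: "nat \<Rightarrow> nat \<Rightarrow> (nat \<Rightarrow> nat) monoid" where
  "dist_transf n l =
    (full_transf n)\<lparr>carrier := {\<alpha> \<in> carrier (full_transf n).
       \<forall>x\<in>{1..n}. \<forall>y\<in>{1..n}.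
         \<bar>int x - int y\<bar> = int l \<longrightarrow> \<bar>int (\<alpha> x) - int (\<alpha> y)\<bar> = int l}\<rparr>"

text \<open>Only \<open>carrier\<close> and \<open>mult\<close> of the record are relevant here, not \<open>one\<close>.\<close>

definition regular_semigroup :: "('a, 'b) monoid_scheme \<Rightarrow> bool" where
  "regular_semigroup S \<longleftrightarrow>
    (\<forall>a\<in>carrier S. \<exists>b\<in>carrier S. a = a \<otimes>\<^bsub>S\<^esub> b \<otimes>\<^bsub>S\<^esub> a)"

lemma full_transf_mult_apply:
  "x \<in> {1..n} \<Longrightarrow> (\<alpha> \<otimes>\<^bsub>full_transf n\<^esub> \<beta>) x = \<beta> (\<alpha> x)"
  by (simp add: full_transf_def compose_def)

lemma monoid_full_transf: "monoid (full_transf n)"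
proof
  fix x y z
  assume "x \<in> carrier (full_transf n)" "y \<in> carrier (full_transf n)" "z \<in> carrier (full_transf n)"
  then show "x \<otimes>\<^bsub>full_transf n\<^esub> y \<otimes>\<^bsub>full_transf n\<^esub> z =
      x \<otimes>\<^bsub>full_transf n\<^esub> (y \<otimes>\<^bsub>full_transf n\<^esub> z)"
    by (fastforce simp: full_transf_def compose_def PiE_def Pi_def)
qed (fastforce simp: full_transf_def compose_def PiE_def Pi_def extensional_def)+

lemma submonoid_dist_transf: "submonoid (carrier (dist_transf n l)) (full_transf n)"
  by standard (auto simp: dist_transf_def full_transf_def compose_def PiE_def Pi_def)

end

theory Submission
  imports Defs
begin

text \<open>\<open>T_n(l)\<close> is the endomorphism monoid of the graph on \<open>{1..n}\<close> with edges \<open>x -- x + l\<close>, a disjoint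
  union of paths, one per residue class modulo \<open>l\<close>.  An endomorphism \<open>\<alpha>\<close> is a regular element iff some
  endomorphism \<open>\<beta>\<close> is a section of \<open>\<alpha>\<close> over its image.  For \<open>n = 2 l\<close> the graph is a perfect matching
  and a section is chosen edge by edge.  For \<open>n < 2 l\<close> an endomorphism sending isolated vertices, and
  nothing else, to a vertex of an edge has no section.  For \<open>n > 2 l\<close>, fold the path of \<open>2\<close> onto the
  edge \<open>{l + 1, 2 l + 1}\<close> and all other paths onto \<open>{1, l + 1}\<close>: a section would map the path
  \<open>1, l + 1, 2 l + 1\<close> to vertices in different components.\<close>

text \<open>The distance condition is symmetric in its two points, so it suffices to test each edge
  from its lower end.\<close>

lemma dist_transf_carrier_iff:
  "\<alpha> \<in> carrier (dist_transf n l) \<longleftrightarrow>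
     \<alpha> \<in> {1..n} \<rightarrow>\<^sub>E {1..n} \<and>
     (\<forall>x\<in>{1..n}. x + l \<le> n \<longrightarrow> \<bar>int (\<alpha> x) - int (\<alpha> (x + l))\<bar> = int l)"
proof -
  have "(\<forall>x\<in>{1..n}. \<forall>y\<in>{1..n}. \<bar>int x - int y\<bar> = int l \<longrightarrow> \<bar>int (\<alpha> x) - int (\<alpha> y)\<bar> = int l) \<longleftrightarrow>
        (\<forall>x\<in>{1..n}. x + l \<le> n \<longrightarrow> \<bar>int (\<alpha> x) - int (\<alpha> (x + l))\<bar> = int l)" (is "?L \<longleftrightarrow> ?R")
  proof
    assume ?L
    then show ?R by auto
  next
    assume R: ?R
    show ?L
    proof (intro ballI impI)
      fix x y assume xy: "x \<in> {1..n}" "y \<in> {1..n}" and d: "\<bar>int x - int y\<bar> = int l"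
      from d consider "y = x + l" | "x = y + l" by linarith
      then show "\<bar>int (\<alpha> x) - int (\<alpha> y)\<bar> = int l"
      proof cases
        case 1
        then show ?thesis using R xy by auto
      next
        case 2
        then have "\<bar>int (\<alpha> y) - int (\<alpha> x)\<bar> = int l" using R xy by auto
        then show ?thesis by linarith
      qed
    qed
  qed
  then show ?thesis by (simp add: dist_transf_def full_transf_def)
qed

lemma restrict_in_dist_transf:
  assumes "\<And>x. 1 \<le> x \<Longrightarrow> x \<le> n \<Longrightarrow> f x \<in> {1..n}"
    and "\<And>x. 1 \<le> x \<Longrightarrow> x + l \<le> n \<Longrightarrow> f (x + l) = f x + l \<or> f x = f (x + l) + l"
  shows "restrict f {1..n} \<in> carrier (dist_transf n l)"
  unfolding dist_transf_carrier_iff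
proof (intro conjI ballI impI)
  show "restrict f {1..n} \<in> {1..n} \<rightarrow>\<^sub>E {1..n}" using assms(1) by auto
next
  fix x assume "x \<in> {1..n}" "x + l \<le> n"
  then show "\<bar>int (restrict f {1..n} x) - int (restrict f {1..n} (x + l))\<bar> = int l"
    using assms(2)[of x] by auto
qed

lemma dist_transf_closed:
  "\<lbrakk>\<alpha> \<in> carrier (dist_transf n l); 1 \<le> x; x \<le> n\<rbrakk> \<Longrightarrow> 1 \<le> \<alpha> x \<and> \<alpha> x \<le> n"
  unfolding dist_transf_carrier_iff by (metis PiE_mem atLeastAtMost_iff)

lemma dist_transf_step:
  assumes "\<alpha> \<in> carrier (dist_transf n l)" "1 \<le> x" "x + l \<le> n"
  shows "\<alpha> (x + l) = \<alpha> x + l \<or> \<alpha> x = \<alpha> (x + l) + l"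
proof -
  have "\<bar>int (\<alpha> x) - int (\<alpha> (x + l))\<bar> = int l"
    using assms by (simp add: dist_transf_carrier_iff)
  then show ?thesis by linarith
qed

text \<open>Evaluated at a point \<open>x\<close>, the equation a = aba says that \<beta> sends
  \<open>\<alpha> x\<close> to some preimage of it. Off the image of \<alpha>, only membership in
  the semigroup constrains \<beta>.\<close>

lemma regular_dist_transf_iff:
  "regular_semigroup (dist_transf n l) \<longleftrightarrow>
     (\<forall>\<alpha>\<in>carrier (dist_transf n l). \<exists>\<beta>\<in>carrier (dist_transf n l).
        \<forall>y\<in>\<alpha> ` {1..n}. \<alpha> (\<beta> y) = y)"
proof -
  have "\<alpha> = \<alpha> \<otimes>\<^bsub>dist_transf n l\<^esub> \<beta> \<otimes>\<^bsub>dist_transf n l\<^esub> \<alpha> \<longleftrightarrow> (\<forall>y\<in>\<alpha> ` {1..n}. \<alpha> (\<beta> y) = y)"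
    if "\<alpha> \<in> carrier (dist_transf n l)" for \<alpha> \<beta>
  proof -
    have "\<alpha> \<in> extensional {1..n}"
      using that by (auto simp: dist_transf_carrier_iff PiE_def)
    moreover have "\<alpha> \<otimes>\<^bsub>dist_transf n l\<^esub> \<beta> \<otimes>\<^bsub>dist_transf n l\<^esub> \<alpha> = (\<lambda>x\<in>{1..n}. \<alpha> (\<beta> (\<alpha> x)))"
      by (auto simp: dist_transf_def full_transf_def compose_def)
    ultimately show ?thesis
      by (auto simp: fun_eq_iff extensional_def restrict_def)
  qed
  then show ?thesis by (simp add: regular_semigroup_def)
qed

lemma regular_dist_transf_matching: "regular_semigroup (dist_transf (2 * l) l)"
  unfolding regular_dist_transf_iff
proof
  fix \<alpha> assume \<alpha>: "\<alpha> \<in> carrier (dist_transf (2 * l) l)"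
  define I where "I = \<alpha> ` {1..2 * l}"
  have I_sub: "I \<subseteq> {1..2 * l}"
    using dist_transf_closed[OF \<alpha>] by (auto simp: I_def)
  have "\<forall>y\<in>I. \<exists>x. 1 \<le> x \<and> x \<le> 2 * l \<and> \<alpha> x = y" by (auto simp: I_def)
  then obtain s where s: "1 \<le> s y \<and> s y \<le> 2 * l \<and> \<alpha> (s y) = y" if "y \<in> I" for y
    by metis
  \<comment> \<open>\<open>p\<close> swaps the ends of each edge. With n = 2 l every vertex has
    exactly one neighbour, so \<alpha> must commute with \<open>p\<close>.\<close>
  define p where "p x = (if x \<le> l then x + l else x - l)" for x
  have p_range: "1 \<le> p x \<and> p x \<le> 2 * l" if "1 \<le> x" "x \<le> 2 * l" for x
    using that by (auto simp: p_def)
  have p_step: "p x = x + l \<or> x = p x + l" for x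
    by (auto simp: p_def)
  have \<alpha>p: "\<alpha> (p x) = p (\<alpha> x)" if x: "1 \<le> x" "x \<le> 2 * l" for x
  proof -
    have "\<alpha> (p x) = \<alpha> x + l \<or> \<alpha> x = \<alpha> (p x) + l"
      using dist_transf_step[OF \<alpha>, of x] dist_transf_step[OF \<alpha>, of "x - l"] x by (auto simp: p_def)
    then show ?thesis
      using dist_transf_closed[OF \<alpha> x] dist_transf_closed[OF \<alpha>, of "p x"] p_range[OF x]
      by (auto simp: p_def[of "\<alpha> x"])
  qed
  have I_p: "p y \<in> I" if "y \<in> I" for y
  proof -
    from that obtain x where "1 \<le> x" "x \<le> 2 * l" "y = \<alpha> x" by (auto simp: I_def)
    then show ?thesis using \<alpha>p[of x] p_range[of x] by (force simp: I_def)
  qed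
  \<comment> \<open>Independent choices of \<open>s\<close> at both ends of an edge might not be
    adjacent, so the upper end gets the partner of the choice made at the lower end. By
    \<open>I_p\<close> the image is a union of edges, so the identity off \<open>I\<close> never
    meets the other cases on one edge.\<close>
  define g where "g y = (if y \<notin> I then y else if y \<le> l then s y else p (s (y - l)))" for y
  have lower: "y - l \<in> I" if "y \<in> I" "l < y" for y
    using I_p[OF that(1)] that(2) by (simp add: p_def)
  have "restrict g {1..2 * l} \<in> carrier (dist_transf (2 * l) l)"
  proof (rule restrict_in_dist_transf)
    show "g y \<in> {1..2 * l}" if "1 \<le> y" "y \<le> 2 * l" for y
      using that s[of y] s[of "y - l"] lower[of y] p_range[of "s (y - l)"] by (auto simp: g_def)
    fix y assume y: "1 \<le> y" "y + l \<le> 2 * l"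
    then have "y + l \<in> I \<longleftrightarrow> y \<in> I"
      using I_p[of y] lower[of "y + l"] by (auto simp: p_def)
    then show "g (y + l) = g y + l \<or> g y = g (y + l) + l"
      using y p_step[of "s y"] by (auto simp: g_def)
  qed
  moreover have "\<alpha> (g y) = y" if y: "y \<in> I" for y
  proof (cases "y \<le> l")
    case True
    then show ?thesis using s[OF y] y by (simp add: g_def)
  next
    case False
    then have low: "y - l \<in> I" "y - l \<le> l" using lower[OF y] y I_sub by auto
    then have "\<alpha> (p (s (y - l))) = p (y - l)" using \<alpha>p s by metis
    then show ?thesis using False y low by (simp add: g_def p_def[of "y - l"])
  qed
  ultimately show "\<exists>\<beta>\<in>carrier (dist_transf (2 * l) l). \<forall>y\<in>\<alpha> ` {1..2 * l}. \<alpha> (\<beta> y) = y"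
    unfolding I_def[symmetric] using I_sub by (intro bexI[of _ "restrict g {1..2 * l}"]) auto
qed

lemma not_regular_dist_transf_isolated:
  assumes "n < 2 * l" "l \<le> n - 2" "n \<ge> 2"
  shows "\<not> regular_semigroup (dist_transf n l)"
proof
  assume reg: "regular_semigroup (dist_transf n l)"
  \<comment> \<open>The value 2 goes exactly to the isolated vertices, those with n - l < x \<le> l;
    \<open>l\<close> is one of them. Since l \<le> n - 2, the vertex 2 itself lies on the edge {2, 2
    + l}.\<close>
  define f where "f x = (if x + l \<le> n then 1 else if l < x then 1 + l else 2)" for x
  let ?\<alpha> = "restrict f {1..n}"
  have "?\<alpha> \<in> carrier (dist_transf n l)"
    by (rule restrict_in_dist_transf) (use assms in \<open>auto simp: f_def\<close>)
  then obtain \<beta> where \<beta>: "\<beta> \<in> carrier (dist_transf n l)"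
    and sec: "\<And>y. y \<in> ?\<alpha> ` {1..n} \<Longrightarrow> ?\<alpha> (\<beta> y) = y"
    using reg unfolding regular_dist_transf_iff by blast
  have "?\<alpha> l = 2" using assms by (auto simp: f_def)
  moreover have "l \<in> {1..n}" using assms by auto
  ultimately have "?\<alpha> (\<beta> 2) = 2" by (metis imageI sec)
  moreover have r: "1 \<le> \<beta> 2" "\<beta> 2 \<le> n" "1 \<le> \<beta> (2 + l)" "\<beta> (2 + l) \<le> n"
    using dist_transf_closed[OF \<beta>, of 2] dist_transf_closed[OF \<beta>, of "2 + l"] assms by auto
  \<comment> \<open>So \<open>\<beta> 2\<close> is isolated, although it must be adjacent to
    \<open>\<beta> (2 + l)\<close>.\<close>
  ultimately have "n < \<beta> 2 + l" "\<beta> 2 \<le> l"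
    using assms by (auto simp: f_def split: if_splits)
  moreover have "\<beta> (2 + l) = \<beta> 2 + l \<or> \<beta> 2 = \<beta> (2 + l) + l"
    using dist_transf_step[OF \<beta>, of 2] assms by auto
  ultimately show False using r by linarith
qed

lemma not_regular_dist_transf_long:
  assumes "2 * l < n" "2 \<le> l"
  shows "\<not> regular_semigroup (dist_transf n l)"
proof
  assume reg: "regular_semigroup (dist_transf n l)"
  \<comment> \<open>The parity of \<open>(x - 1) div l\<close> folds each path onto an edge, and
    \<open>(x - 1) mod l\<close> names the path. The two target edges share l + 1, but 1 is attained
    only off the path of 2, and 2 l + 1 only on it.\<close>
  define f where "f x = (if even ((x - 1) div l) then 1 else l + 1) +
    (if (x - 1) mod l = 1 then l else 0)" for x
  let ?\<alpha> = "restrict f {1..n}"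
  have shift: "(x + l - 1) div l = Suc ((x - 1) div l)" "(x + l - 1) mod l = (x - 1) mod l"
    if "1 \<le> x" for x
  proof -
    have "x + l - 1 = (x - 1) + l" using that by simp
    then show "(x + l - 1) div l = Suc ((x - 1) div l)" "(x + l - 1) mod l = (x - 1) mod l"
      using assms(2) by (auto simp only: div_add_self2 mod_add_self2)
  qed
  have "?\<alpha> \<in> carrier (dist_transf n l)"
  proof (rule restrict_in_dist_transf)
    show "f x \<in> {1..n}" for x using assms by (auto simp: f_def)
    show "f (x + l) = f x + l \<or> f x = f (x + l) + l" if "1 \<le> x" for x
      unfolding f_def shift[OF that] by auto
  qed
  then obtain \<beta> where \<beta>: "\<beta> \<in> carrier (dist_transf n l)"
    and sec: "\<And>y. y \<in> ?\<alpha> ` {1..n} \<Longrightarrow> ?\<alpha> (\<beta> y) = y"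
    using reg unfolding regular_dist_transf_iff by blast
  have r: "1 \<le> \<beta> 1" "\<beta> 1 \<le> n" "1 \<le> \<beta> (1 + l)" "1 \<le> \<beta> (1 + l + l)" "\<beta> (1 + l + l) \<le> n"
    using dist_transf_closed[OF \<beta>, of 1] dist_transf_closed[OF \<beta>, of "1 + l"]
      dist_transf_closed[OF \<beta>, of "1 + l + l"] assms by auto
  have "?\<alpha> 1 = 1" using assms by (auto simp: f_def)
  moreover have "1 \<in> {1..n}" using assms by auto
  ultimately have "?\<alpha> (\<beta> 1) = 1" by (metis imageI sec)
  then have c1: "(\<beta> 1 - 1) mod l \<noteq> 1"
    using r assms by (auto simp: f_def split: if_splits)
  \<comment> \<open>On the path of 2, the vertex 2 + l comes right after 2, so its quotient is odd
    and it attains the top value.\<close>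
  have "?\<alpha> (2 + l) = 1 + l + l"
    unfolding f_def using assms shift[of 2] by (simp add: f_def)
  moreover have "2 + l \<in> {1..n}" using assms by auto
  ultimately have "?\<alpha> (\<beta> (1 + l + l)) = 1 + l + l" by (metis imageI sec)
  then have c2: "(\<beta> (1 + l + l) - 1) mod l = 1"
    using r assms by (auto simp: f_def split: if_splits)
  \<comment> \<open>Adjacent vertices lie on the same path, so \<beta> keeps the images of 1, 1 + l
    and 1 + 2 l on one path, against \<open>c1\<close> and \<open>c2\<close>.\<close>
  have same: "(\<beta> (x + l) - 1) mod l = (\<beta> x - 1) mod l"
    if "1 \<le> x" "x + l \<le> n" "1 \<le> \<beta> x" "1 \<le> \<beta> (x + l)" for x
    using dist_transf_step[OF \<beta> that(1,2)] shift(2)[OF that(3)] shift(2)[OF that(4)] by auto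
  show False
    using same[of 1] same[of "1 + l"] c1 c2 r assms by auto
qed

theorem theorem3p3:
  fixes n l :: nat
  assumes "n \<ge> 4" and "2 \<le> l" and "l \<le> n - 2"
  shows "regular_semigroup (dist_transf n l) \<longleftrightarrow> even n \<and> l = n div 2"
proof -
  consider "n < 2 * l" | "n = 2 * l" | "2 * l < n" by linarith
  then show ?thesis
  proof cases
    case 1
    then show ?thesis using not_regular_dist_transf_isolated[of n l] assms by auto
  next
    case 2
    then show ?thesis using regular_dist_transf_matching[of l] by simp
  next
    case 3
    then show ?thesis using not_regular_dist_transf_long[of l n] assms by auto
  qed
qed

end
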